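(* Let $N\ge 2$, let $\Omega\subset\mathbb{R}^N$ be a bounded open set with Lipschitz boundary and $0\in\Omega$, let $\gamma>0$, $\lambda\in\mathbb{R}$, and let $f\in L^{N,\infty}(\Omega)$ be positive ($f>0$ a.e. in $\Omega$). Let $u\in BV(\Omega)$ be a solution, in the sense of the definition in the context, to $$-\Delta_1 u=\frac{\lambda}{|x|}\,\mathrm{Sgn}(u)+\frac{f}{u^\gamma}\ \text{ in }\Omega,\qquad u=0\ \text{ on }\partial\Omega .$$ Then $u(x)>0$ for a.e. $x\in\Omega$.
   Context: $L^{N,\infty}(\Omega)$ is the Lorentz (weak-$L^N$) space. $\mathrm{Sgn}(s)=\{s/|s|\}$ for $s\ne0$, $\mathrm{Sgn}(0)=[-1,1]$. $X_{\mathcal M}(\Omega)$ (resp. $X_{\mathcal M_{loc}}(\Omega)$) is the set of ${\bf z}\in L^\infty(\Omega,\mathbb{R}^N)$ whose distributional divergence is a finite (resp. locally finite) Radon measure on $\Omega$. For such ${\bf z}$, $|\mathrm{div}\,{\bf z}|$ is absolutely continuous with respect to $\mathcal H^{N-1}$. For $v\in BV_{loc}(\Omega)$, $v^*$ denotes the precise representative (equal to the approximate limit where it exists and to the average $(v^++v^-)/2$ at approximate jump points; defined $\mathcal H^{N-1}$-a.e.). Pairing: for ${\bf z}\in X_{\mathcal M_{loc}}(\Omega)$ and $v\in BV_{loc}(\Omega)$ with $v^*\in L^1_{loc}(\Omega,\mathrm{div}\,{\bf z})$, define the distribution (in fact a Radon measure) $$\langle({\bf z},Dv),\varphi\rangle=-\int_\Omega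 v^*\varphi\,\mathrm{div}\,{\bf z}-\int_\Omega v\,{\bf z}\cdot\nabla\varphi\,dx,\quad\varphi\in C_c^\infty(\Omega).$$ Normal trace: for ${\bf w}\in X_{\mathcal M}(\Omega)$, $[{\bf w},\nu]\in L^\infty(\partial\Omega)$ is Anzellotti's weak trace of the normal component ($\nu$ outward unit normal), characterized by $\int_\Omega v\,\mathrm{div}\,{\bf w}+\int_\Omega{\bf w}\cdot\nabla v\,dx=\int_{\partial\Omega}v[{\bf w},\nu]\,d\mathcal H^{N-1}$ for $v\in C^1(\overline\Omega)$. Definition of solution: a nonnegative $u\in BV(\Omega)$ is a solution if there is ${\bf z}\in X_{\mathcal M_{loc}}(\Omega)$ with $\|{\bf z}\|_{L^\infty(\Omega)}\le1$ such that (a) $f/u^\gamma\in L^1_{loc}(\Omega)$ (with $f/u^\gamma=+\infty$ where $u=0<f$); (b) $\chi_{\{u>0\}}\in BV_{loc}(\Omega)$; (c) $-\chi_{\{u>0\}}^*\,\mathrm{div}\,{\bf z}=\frac{\lambda}{|x|}\chi_{\{u>0\}}+\frac{f}{u^\gamma}$ in $\mathcal D'(\Omega)$; (d) $({\bf z},Du)=|Du|$ as Radon measures on $\Omega$; (e) for every $0\le\phi\in C^1(\overline\Omega)\cap L^1(\Omega,\mathrm{div}\,{\bf z})$ with $\sup_\Omega\phi\le\phi(y)$ for all $y\in\partial\Omega$, and for $\mathcal H^{N-1}$-a.e. $x\in\partial\Omega$, one has $\lim_{\rho\downarrow0}\rho^{-N}\int_{\Omega\cap B_\rho(x)}u(y)\,dy=0$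 or $\phi(x)+[\phi{\bf z},\nu](x)=0$. *)

theory Defs
  imports "HOL-Analysis.Analysis"
begin

text \<open>
  Throughout, \<open>\<Omega>\<close> is an open subset of a Euclidean space and functions are defined on the whole
  space, but only their values on \<open>\<Omega>\<close> (or on its closure, resp. boundary) matter.
\<close>

subsection \<open>Smooth functions\<close>

definition grad :: "('a::euclidean_space \<Rightarrow> real) \<Rightarrow> 'a \<Rightarrow> 'a" where
  "grad g x = (THE D. GDERIV g x :> D)"

fun C_k :: "nat \<Rightarrow> ('a::euclidean_space \<Rightarrow> real) \<Rightarrow> bool" where
  "C_k 0 g \<longleftrightarrow> continuous_on UNIV g"
| "C_k (Suc k) g \<longleftrightarrow> (\<forall>x. g differentiable (at x)) \<and>
     (\<forall>b\<in>Basis. C_k k (\<lambda>x. frechet_derivative g (at x) b))"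

text \<open>\<open>C\<^sub>c\<^sup>\<infinity>(\<Omega>)\<close>; a test function is extended by zero to the whole space.\<close>

definition test_fun :: "'a::euclidean_space set \<Rightarrow> ('a \<Rightarrow> real) set" where
  "test_fun \<Omega> = {\<phi>. (\<forall>k. C_k k \<phi>) \<and> compact (closure {x. \<phi> x \<noteq> 0}) \<and> closure {x. \<phi> x \<noteq> 0} \<subseteq> \<Omega>}"

text \<open>\<open>C\<^sup>1\<close> up to the boundary: the function and its gradient extend continuously to the closure.\<close>

definition C1_closure :: "'a::euclidean_space set \<Rightarrow> ('a \<Rightarrow> real) set" where
  "C1_closure \<Omega> = {g. continuous_on (closure \<Omega>) g \<and>
     (\<exists>G. continuous_on (closure \<Omega>) G \<and> (\<forall>x\<in>\<Omega>. GDERIV g x :> G x))}"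

subsection \<open>Lipschitz boundary, Hausdorff measure\<close>

text \<open>Near each boundary point, in coordinates with vertical axis \<open>e\<close>, the set is the strict
  epigraph of a Lipschitz function on the hyperplane orthogonal to \<open>e\<close>.\<close>

definition lipschitz_boundary :: "'a::euclidean_space set \<Rightarrow> bool" where
  "lipschitz_boundary \<Omega> \<longleftrightarrow> (\<forall>p\<in>frontier \<Omega>. \<exists>r>0. \<exists>e g L. norm e = 1 \<and>
     L-lipschitz_on {y. y \<bullet> e = 0} g \<and>
     \<Omega> \<inter> ball p r = {y \<in> ball p r. g (y - (y \<bullet> e) *\<^sub>R e) < y \<bullet> e})"

definition hausdorff_pre :: "real \<Rightarrow> real \<Rightarrow> 'a::euclidean_space set \<Rightarrow> ennreal" where
  "hausdorff_pre s \<delta> A =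
     (INF C \<in> {C :: nat \<Rightarrow> 'a set. A \<subseteq> (\<Union>i. C i) \<and> (\<forall>i. bounded (C i) \<and> diameter (C i) \<le> \<delta>)}.
        \<Sum>i. ennreal (unit_ball_vol s * (diameter (C i) / 2) powr s))"

text \<open>The normalisation makes \<open>\<H>\<^sup>N\<^sup>-\<^sup>1\<close> agree with surface measure. Used only for \<open>s > 0\<close>.\<close>

definition hausdorff_measure :: "real \<Rightarrow> 'a::euclidean_space measure" where
  "hausdorff_measure s = measure_of UNIV (sets borel) (\<lambda>A. SUP \<delta>\<in>{0<..}. hausdorff_pre s \<delta> A)"

definition boundary_measure :: "'a::euclidean_space set \<Rightarrow> 'a measure" where
  "boundary_measure \<Omega> = restrict_space (hausdorff_measure (real DIM('a) - 1)) (frontier \<Omega>)"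

subsection \<open>Local integrability, weak Lebesgue spaces\<close>

definition loc_integrable :: "'a::euclidean_space set \<Rightarrow> 'a measure \<Rightarrow> ('a \<Rightarrow> real) \<Rightarrow> bool" where
  "loc_integrable \<Omega> M v \<longleftrightarrow> (\<forall>K. compact K \<and> K \<subseteq> \<Omega> \<longrightarrow> set_integrable M K v)"

definition loc_integrable_ereal :: "'a::euclidean_space set \<Rightarrow> ('a \<Rightarrow> ereal) \<Rightarrow> bool" where
  "loc_integrable_ereal \<Omega> g \<longleftrightarrow> g \<in> borel_measurable (lebesgue_on \<Omega>) \<and>
     (\<forall>K. compact K \<and> K \<subseteq> \<Omega> \<longrightarrow> (\<integral>\<^sup>+x\<in>K. e2ennreal \<bar>g x\<bar> \<partial>lebesgue_on \<Omega>) < \<infinity>)"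

text \<open>\<open>L\<^sup>p\<^sup>,\<^sup>\<infinity>(\<Omega>)\<close>: the quasi-norm \<open>sup\<^sub>t\<^sub>>\<^sub>0 t |{|f| > t}|\<^sup>1\<^sup>/\<^sup>p\<close>, here raised to the power \<open>p\<close>, is finite.\<close>

definition weak_L :: "real \<Rightarrow> 'a::euclidean_space set \<Rightarrow> ('a \<Rightarrow> real) set" where
  "weak_L p \<Omega> = {f \<in> borel_measurable (lebesgue_on \<Omega>).
     (SUP t\<in>{0<..}. ennreal (t powr p) * emeasure lebesgue {x\<in>\<Omega>. t < \<bar>f x\<bar>}) < \<infinity>}"

subsection \<open>Radon measures\<close>

text \<open>
  A (locally finite) real- or vector-valued Radon measure \<open>\<mu>\<close> on \<open>\<Omega>\<close> is encoded by its polar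
  decomposition \<open>\<mu> = \<sigma> |\<mu>|\<close>, i.e. as the pair of its total variation \<open>|\<mu>|\<close>, a positive Borel measure
  finite on compact subsets of \<open>\<Omega>\<close>, and a density \<open>\<sigma>\<close> with \<open>|\<sigma>| = 1\<close> almost everywhere.
  (A signed measure that is only locally finite is not a set function on all Borel subsets of \<open>\<Omega>\<close>.)
\<close>

type_synonym ('a, 'e) radon = "'a measure \<times> ('a \<Rightarrow> 'e)"

abbreviation tv :: "('a, 'e) radon \<Rightarrow> 'a measure" where
  "tv \<mu> \<equiv> fst \<mu>"

definition radon_on :: "'a::euclidean_space set \<Rightarrow> ('a, 'e::euclidean_space) radon \<Rightarrow> bool" where
  "radon_on \<Omega> \<mu> \<longleftrightarrow> sets (tv \<mu>) = sets (restrict_space borel \<Omega>) \<and>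
     (\<forall>K. compact K \<and> K \<subseteq> \<Omega> \<longrightarrow> emeasure (tv \<mu>) K < \<infinity>) \<and>
     snd \<mu> \<in> borel_measurable (tv \<mu>) \<and> (AE x in tv \<mu>. norm (snd \<mu> x) = 1)"

definition finite_radon_on :: "'a::euclidean_space set \<Rightarrow> ('a, 'e::euclidean_space) radon \<Rightarrow> bool" where
  "finite_radon_on \<Omega> \<mu> \<longleftrightarrow> radon_on \<Omega> \<mu> \<and> emeasure (tv \<mu>) \<Omega> < \<infinity>"

definition radon_integral :: "('a, 'e::euclidean_space) radon \<Rightarrow> ('a \<Rightarrow> real) \<Rightarrow> 'e" where
  "radon_integral \<mu> g = (LINT x|tv \<mu>. g x *\<^sub>R snd \<mu> x)"

subsection \<open>Distributional divergence and derivative\<close>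

text \<open>In the two definitions by choice below, the measure is unique: \<open>|\<mu>|\<close> is determined, and \<open>\<sigma>\<close>
  is determined \<open>|\<mu>|\<close>-almost everywhere.\<close>

definition has_distr_div ::
    "'a::euclidean_space set \<Rightarrow> ('a \<Rightarrow> 'a) \<Rightarrow> ('a, real) radon \<Rightarrow> bool" where
  "has_distr_div \<Omega> z \<mu> \<longleftrightarrow> radon_on \<Omega> \<mu> \<and>
     (\<forall>\<phi>\<in>test_fun \<Omega>. radon_integral \<mu> \<phi> = - (LINT x|lebesgue_on \<Omega>. z x \<bullet> grad \<phi> x))"

definition distr_div :: "'a::euclidean_space set \<Rightarrow> ('a \<Rightarrow> 'a) \<Rightarrow> ('a, real) radon" where
  "distr_div \<Omega> z = (SOME \<mu>. has_distr_div \<Omega> z \<mu>)"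

definition has_distr_deriv ::
    "'a::euclidean_space set \<Rightarrow> ('a \<Rightarrow> real) \<Rightarrow> ('a, 'a) radon \<Rightarrow> bool" where
  "has_distr_deriv \<Omega> v \<mu> \<longleftrightarrow> radon_on \<Omega> \<mu> \<and>
     (\<forall>\<phi>\<in>test_fun \<Omega>. radon_integral \<mu> \<phi> = - (LINT x|lebesgue_on \<Omega>. v x *\<^sub>R grad \<phi> x))"

definition distr_deriv :: "'a::euclidean_space set \<Rightarrow> ('a \<Rightarrow> real) \<Rightarrow> ('a, 'a) radon" where
  "distr_deriv \<Omega> v = (SOME \<mu>. has_distr_deriv \<Omega> v \<mu>)"

definition L_infty_field :: "'a::euclidean_space set \<Rightarrow> ('a \<Rightarrow> 'a) set" where
  "L_infty_field \<Omega> = {z \<in> borel_measurable (lebesgue_on \<Omega>).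
     \<exists>C. AE x in lebesgue_on \<Omega>. norm (z x) \<le> C}"

definition X_M :: "'a::euclidean_space set \<Rightarrow> ('a \<Rightarrow> 'a) set" where
  "X_M \<Omega> = {z \<in> L_infty_field \<Omega>. \<exists>\<mu>. has_distr_div \<Omega> z \<mu> \<and> finite_radon_on \<Omega> \<mu>}"

definition X_M_loc :: "'a::euclidean_space set \<Rightarrow> ('a \<Rightarrow> 'a) set" where
  "X_M_loc \<Omega> = {z \<in> L_infty_field \<Omega>. \<exists>\<mu>. has_distr_div \<Omega> z \<mu>}"

definition BV :: "'a::euclidean_space set \<Rightarrow> ('a \<Rightarrow> real) set" where
  "BV \<Omega> = {v. integrable (lebesgue_on \<Omega>) v \<and>
     (\<exists>\<mu>. has_distr_deriv \<Omega> v \<mu> \<and> finite_radon_on \<Omega> \<mu>)}"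

definition BV_loc :: "'a::euclidean_space set \<Rightarrow> ('a \<Rightarrow> real) set" where
  "BV_loc \<Omega> = {v. loc_integrable \<Omega> (lebesgue_on \<Omega>) v \<and> (\<exists>\<mu>. has_distr_deriv \<Omega> v \<mu>)}"

subsection \<open>Precise representative\<close>

definition approx_limit :: "('a::euclidean_space \<Rightarrow> real) \<Rightarrow> 'a \<Rightarrow> real \<Rightarrow> bool" where
  "approx_limit v x l \<longleftrightarrow>
     ((\<lambda>\<rho>. (\<integral>\<^sup>+y\<in>ball x \<rho>. ennreal \<bar>v y - l\<bar> \<partial>lebesgue) / ennreal (\<rho> ^ DIM('a)))
        \<longlongrightarrow> 0) (at_right 0)"

text \<open>One-sided approximate limits \<open>a\<close>, \<open>b\<close> on the two half balls cut out by the direction \<open>\<nu>\<close>.\<close>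

definition approx_jump :: "('a::euclidean_space \<Rightarrow> real) \<Rightarrow> 'a \<Rightarrow> real \<Rightarrow> real \<Rightarrow> 'a \<Rightarrow> bool" where
  "approx_jump v x a b \<nu> \<longleftrightarrow> a \<noteq> b \<and> norm \<nu> = 1 \<and>
     ((\<lambda>\<rho>. (\<integral>\<^sup>+y\<in>{y \<in> ball x \<rho>. 0 < (y - x) \<bullet> \<nu>}. ennreal \<bar>v y - a\<bar> \<partial>lebesgue)
            / ennreal (\<rho> ^ DIM('a))) \<longlongrightarrow> 0) (at_right 0) \<and>
     ((\<lambda>\<rho>. (\<integral>\<^sup>+y\<in>{y \<in> ball x \<rho>. (y - x) \<bullet> \<nu> < 0}. ennreal \<bar>v y - b\<bar> \<partial>lebesgue)
            / ennreal (\<rho> ^ DIM('a))) \<longlongrightarrow> 0) (at_right 0)"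

text \<open>The triple \<open>(a, b, \<nu>)\<close> at a jump point is unique up to exchanging it with \<open>(b, a, -\<nu>)\<close>, so the
  average is well defined. The default value \<open>0\<close> is taken only on an \<open>\<H>\<^sup>N\<^sup>-\<^sup>1\<close>-null set if \<open>v\<close> is
  locally of bounded variation. At points of \<open>\<Omega>\<close> only the values of \<open>v\<close> in \<open>\<Omega>\<close> matter.\<close>

definition precise_rep :: "('a::euclidean_space \<Rightarrow> real) \<Rightarrow> 'a \<Rightarrow> real" where
  "precise_rep v x =
     (if \<exists>l. approx_limit v x l then (THE l. approx_limit v x l)
      else if \<exists>a b \<nu>. approx_jump v x a b \<nu> then (THE c. \<exists>a b \<nu>. approx_jump v x a b \<nu> \<and> c = (a + b) / 2)
      else 0)"

subsection \<open>Pairing and normal trace\<close>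

definition pairing ::
    "'a::euclidean_space set \<Rightarrow> ('a \<Rightarrow> 'a) \<Rightarrow> ('a \<Rightarrow> real) \<Rightarrow> ('a \<Rightarrow> real) \<Rightarrow> real" where
  "pairing \<Omega> z v \<phi> =
     - radon_integral (distr_div \<Omega> z) (\<lambda>x. precise_rep v x * \<phi> x)
     - (LINT x|lebesgue_on \<Omega>. v x * (z x \<bullet> grad \<phi> x))"

definition is_normal_trace ::
    "'a::euclidean_space set \<Rightarrow> ('a \<Rightarrow> 'a) \<Rightarrow> ('a \<Rightarrow> real) \<Rightarrow> bool" where
  "is_normal_trace \<Omega> w t \<longleftrightarrow> t \<in> borel_measurable (boundary_measure \<Omega>) \<and>
     (\<exists>C. AE x in boundary_measure \<Omega>. \<bar>t x\<bar> \<le> C) \<and>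
     (\<forall>v\<in>C1_closure \<Omega>.
        radon_integral (distr_div \<Omega> w) v + (LINT x|lebesgue_on \<Omega>. w x \<bullet> grad v x)
          = (LINT x|boundary_measure \<Omega>. v x * t x))"

text \<open>For \<open>w \<in> X_M \<Omega>\<close> the trace exists (Anzellotti) and is unique almost everywhere on the boundary.\<close>

definition normal_trace :: "'a::euclidean_space set \<Rightarrow> ('a \<Rightarrow> 'a) \<Rightarrow> 'a \<Rightarrow> real" where
  "normal_trace \<Omega> w = (SOME t. is_normal_trace \<Omega> w t)"

subsection \<open>Solutions\<close>

definition sing_term :: "real \<Rightarrow> ('a \<Rightarrow> real) \<Rightarrow> ('a \<Rightarrow> real) \<Rightarrow> 'a \<Rightarrow> ereal" where
  "sing_term \<gamma> f u x =
     (if u x = 0 then (if 0 < f x then \<infinity> else 0) else ereal (f x / u x powr \<gamma>))"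

abbreviation chi_pos :: "('a \<Rightarrow> real) \<Rightarrow> 'a \<Rightarrow> real" where
  "chi_pos u \<equiv> indicat_real {x. 0 < u x}"

text \<open>
  Solutions of \<open>-\<Delta>\<^sub>1 u = (lam / |x|) Sgn u + f / u\<^sup>\<gamma>\<close> in \<open>\<Omega>\<close> with \<open>u = 0\<close> on the boundary. The clause
  that the precise representative of \<open>u\<close> is locally \<open>|div z|\<close>-integrable is the condition under
  which the pairing in the clause following it is defined.
\<close>

definition is_solution ::
    "'a::euclidean_space set \<Rightarrow> real \<Rightarrow> real \<Rightarrow> ('a \<Rightarrow> real) \<Rightarrow> ('a \<Rightarrow> real) \<Rightarrow> bool" where
  "is_solution \<Omega> lam \<gamma> f u \<longleftrightarrow>
     u \<in> BV \<Omega> \<and> (AE x in lebesgue_on \<Omega>. 0 \<le> u x) \<and>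
     (\<exists>z \<in> X_M_loc \<Omega>. (AE x in lebesgue_on \<Omega>. norm (z x) \<le> 1) \<and>
        loc_integrable_ereal \<Omega> (sing_term \<gamma> f u) \<and>
        chi_pos u \<in> BV_loc \<Omega> \<and>
        (\<forall>\<phi>\<in>test_fun \<Omega>.
           - radon_integral (distr_div \<Omega> z) (\<lambda>x. precise_rep (chi_pos u) x * \<phi> x)
             = (LINT x|lebesgue_on \<Omega>.
                  (lam / norm x * chi_pos u x + real_of_ereal (sing_term \<gamma> f u x)) * \<phi> x)) \<and>
        loc_integrable \<Omega> (tv (distr_div \<Omega> z)) (precise_rep u) \<and>
        (\<forall>\<phi>\<in>test_fun \<Omega>. pairing \<Omega> z u \<phi> = (LINT x|tv (distr_deriv \<Omega> u). \<phi> x)) \<and>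
        (\<forall>\<phi>\<in>C1_closure \<Omega>.
           (\<forall>x\<in>\<Omega>. 0 \<le> \<phi> x) \<and> integrable (tv (distr_div \<Omega> z)) \<phi> \<and>
           (\<forall>y\<in>frontier \<Omega>. (SUP x\<in>\<Omega>. \<phi> x) \<le> \<phi> y) \<longrightarrow>
           (AE x in boundary_measure \<Omega>.
              ((\<lambda>\<rho>. (LINT y:\<Omega> \<inter> ball x \<rho>|lebesgue. u y) / \<rho> ^ DIM('a)) \<longlongrightarrow> 0) (at_right 0) \<or>
              \<phi> x + normal_trace \<Omega> (\<lambda>y. \<phi> y *\<^sub>R z y) x = 0)))"

end

theory Submission
  imports Defs
begin

text \<open>
  Positivity is forced by the local integrability of \<open>f / u\<^sup>\<gamma>\<close>. By the convention at \<open>u = 0\<close> this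
  quotient is \<open>+\<infinity>\<close> wherever \<open>u\<close> vanishes and \<open>f\<close> is positive, whereas a locally integrable
  extended-real function is finite almost everywhere
  (\<open>loc_integrable_ereal_finite_AE\<close>). As \<open>f > 0\<close> almost everywhere, \<open>u\<close> can vanish only on a null set,
  and \<open>u \<ge> 0\<close> then gives \<open>u > 0\<close>.
\<close>

text \<open>
  Integrability is given on compact sets only, and an open set is exhausted by countably many of
  them, so the null sets on which the function is infinite add up to a null set.
\<close>

lemma loc_integrable_ereal_finite_AE:
  fixes \<Omega> :: "'a::euclidean_space set"
  assumes "open \<Omega>" and g: "loc_integrable_ereal \<Omega> g"
  shows "AE x in lebesgue_on \<Omega>. \<bar>g x\<bar> \<noteq> \<infinity>"
proof -
  obtain C :: "nat \<Rightarrow> 'a set"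
    where C: "\<And>n. compact (C n)" "\<And>n. C n \<subseteq> \<Omega>" "\<Union>(range C) = \<Omega>"
    using open_Union_compact_subsets[OF \<open>open \<Omega>\<close>] by metis
  have [measurable]: "g \<in> borel_measurable (lebesgue_on \<Omega>)"
    using g by (simp add: loc_integrable_ereal_def)
  have "AE x in lebesgue_on \<Omega>. x \<in> C n \<longrightarrow> \<bar>g x\<bar> \<noteq> \<infinity>" for n
  proof -
    have [measurable]: "C n \<in> sets (lebesgue_on \<Omega>)"
      using C(1,2)[of n] \<open>open \<Omega>\<close> by (simp add: sets_restrict_space_iff borel_compact)
    have "(\<integral>\<^sup>+x. e2ennreal \<bar>g x\<bar> * indicator (C n) x \<partial>lebesgue_on \<Omega>) \<noteq> \<infinity>"
      using g C(1,2)[of n] by (auto simp: loc_integrable_ereal_def)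
    then have "AE x in lebesgue_on \<Omega>. e2ennreal \<bar>g x\<bar> * indicator (C n) x \<noteq> \<infinity>"
      by (intro nn_integral_noteq_infinite) measurable
    then show ?thesis
      by eventually_elim (auto simp: e2ennreal_infty)
  qed
  then have "AE x in lebesgue_on \<Omega>. \<forall>n. x \<in> C n \<longrightarrow> \<bar>g x\<bar> \<noteq> \<infinity>"
    by (subst AE_all_countable) blast
  then show ?thesis
    using AE_space by eventually_elim (use C(3) in auto)
qed

theorem lemma6p1:
  fixes \<Omega> :: "(real ^ 'n) set"
    and lam \<gamma> :: real
    and f u :: "real ^ 'n \<Rightarrow> real"
  assumes "2 \<le> CARD('n)"
    and "open \<Omega>" and "bounded \<Omega>" and "lipschitz_boundary \<Omega>" and "0 \<in> \<Omega>"
    and "0 < \<gamma>"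
    and "f \<in> weak_L (real CARD('n)) \<Omega>"
    and "AE x in lebesgue_on \<Omega>. 0 < f x"
    and "u \<in> BV \<Omega>"
    and "is_solution \<Omega> lam \<gamma> f u"
  shows "AE x in lebesgue_on \<Omega>. 0 < u x"
proof -
  have "loc_integrable_ereal \<Omega> (sing_term \<gamma> f u)" and nonneg: "AE x in lebesgue_on \<Omega>. 0 \<le> u x"
    using \<open>is_solution \<Omega> lam \<gamma> f u\<close> unfolding is_solution_def by blast+
  then have "AE x in lebesgue_on \<Omega>. \<bar>sing_term \<gamma> f u x\<bar> \<noteq> \<infinity>"
    using \<open>open \<Omega>\<close> by (intro loc_integrable_ereal_finite_AE)
  with nonneg \<open>AE x in lebesgue_on \<Omega>. 0 < f x\<close> show ?thesis
    by eventually_elim (auto simp: sing_term_def less_le split: if_splits)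
qed

end
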